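(* Let $A$ be a finite alphabet. For every recurrent shift space $X\subseteq A^{\mathbb Z}$, the continuous spectrum of $X$ and the continuous spectrum of the one-sided shift space $X^+$ are equal.
   Context: $S$ denotes the shift transformation, $S(x)_n=x_{n+1}$, on $A^{\mathbb Z}$ or $A^{\mathbb N}$, each carrying the product topology. A shift space is a closed subset $X$ of $A^{\mathbb Z}$ with $S(X)=X$. For $x\in A^{\mathbb Z}$, $x^+=x_0x_1\cdots$, and $X^+=\{x^+\mid x\in X\}\subseteq A^{\mathbb N}$. The language $\mathcal L(X)$ is the set of factors of the sequences in $X$. A shift space $X$ is recurrent if for every $u,v\in\mathcal L(X)$ there is a word $w$ such that $uwv\in\mathcal L(X)$. A topological dynamical system is a pair $(X,T)$ of a compact metric space $X$ and a continuous map $T\colon X\to X$; shift spaces and one-sided shift spaces are considered with $T=S$. A complex number $\lambda$ is a continuous eigenvalue of $(X,T)$ if there is a continuous function $f\colon X\to\mathbb C$, not identically zero, such that $f\circ T=\lambda f$. The continuous spectrum of $(X,T)$ is the set of its continuous eigenvalues. *)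

theory Defs
  imports "HOL-Analysis.Analysis"
begin

text \<open>
  The index type \<open>'i\<close> is \<open>int\<close> for two-sided and \<open>nat\<close> for one-sided sequences. The alphabet is a
  set \<open>A\<close>, so the underlying set of \<open>sequence_topology A\<close> consists of the sequences with values
  in \<open>A\<close>.
\<close>

definition sequence_topology :: "'a set \<Rightarrow> ('i \<Rightarrow> 'a) topology" where
  "sequence_topology A = product_topology (\<lambda>_. discrete_topology A) UNIV"

definition shift :: "('i::{plus,one} \<Rightarrow> 'a) \<Rightarrow> 'i \<Rightarrow> 'a" where
  "shift x = (\<lambda>n. x (n + 1))"

definition shift_space :: "'a set \<Rightarrow> (int \<Rightarrow> 'a) set \<Rightarrow> bool" where
  "shift_space A X \<longleftrightarrow> closedin (sequence_topology A) X \<and> shift ` X = X"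

definition right_part :: "(int \<Rightarrow> 'a) \<Rightarrow> nat \<Rightarrow> 'a" where
  "right_part x = (\<lambda>n. x (int n))"

definition one_sided :: "(int \<Rightarrow> 'a) set \<Rightarrow> (nat \<Rightarrow> 'a) set" where
  "one_sided X = right_part ` X"

definition factor :: "(int \<Rightarrow> 'a) \<Rightarrow> int \<Rightarrow> nat \<Rightarrow> 'a list" where
  "factor x i n = map (\<lambda>k. x (i + int k)) [0..<n]"

definition language :: "(int \<Rightarrow> 'a) set \<Rightarrow> 'a list set" where
  "language X = {factor x i n | x i n. x \<in> X}"

definition recurrent :: "(int \<Rightarrow> 'a) set \<Rightarrow> bool" where
  "recurrent X \<longleftrightarrow> (\<forall>u\<in>language X. \<forall>v\<in>language X. \<exists>w. u @ w @ v \<in> language X)"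

text \<open>
  The phase space is the underlying set of the topology \<open>X\<close>; values of \<open>T\<close> and \<open>f\<close> outside it
  are irrelevant.
\<close>

definition continuous_spectrum :: "'x topology \<Rightarrow> ('x \<Rightarrow> 'x) \<Rightarrow> complex set" where
  "continuous_spectrum X T =
    {c. \<exists>f. continuous_map X euclidean f \<and> (\<exists>x\<in>topspace X. f x \<noteq> 0) \<and>
         (\<forall>x\<in>topspace X. f (T x) = c * f x)}"

end

theory Submission
  imports Defs
begin

text \<open>
  An eigenfunction \<open>g\<close> on \<open>X\<^sup>+\<close> pulls back to \<open>x \<mapsto> g (x\<^sup>+)\<close>. Conversely, let \<open>f\<close> be an eigenfunction
  on \<open>X\<close> for \<open>c\<close>. Since \<open>S\<close> maps the compact space \<open>X\<close> onto itself, the maximum of \<open>\<bar>f\<bar>\<close> shows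
  \<open>\<bar>c\<bar> \<ge> 1\<close>. If \<open>x\<^sup>+ = y\<^sup>+\<close>, then \<open>S\<^sup>n x\<close> and \<open>S\<^sup>n y\<close> become close, so by uniform continuity
  \<open>\<bar>c\<bar>\<^sup>n \<bar>f x - f y\<bar> = \<bar>f (S\<^sup>n x) - f (S\<^sup>n y)\<bar>\<close> tends to \<open>0\<close> and \<open>f x = f y\<close>. Hence \<open>f\<close> factors
  through the quotient map \<open>x \<mapsto> x\<^sup>+\<close>.
\<close>

lemma topspace_sequence_topology: "topspace (sequence_topology A) = {x. \<forall>i. x i \<in> A}"
  by (auto simp: sequence_topology_def PiE_def)

lemma compact_space_sequence_topology:
  assumes "finite A"
  shows "compact_space (sequence_topology A)"
  unfolding sequence_topology_def using assms
  by (simp add: compact_space_product_topology compact_space_discrete_topology)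

lemma Hausdorff_space_sequence_topology: "Hausdorff_space (sequence_topology A)"
  unfolding sequence_topology_def by (simp add: Hausdorff_space_product_topology)

lemma openin_sequence_topology_cylinder:
  assumes "finite F"
  shows "openin (sequence_topology A) {y \<in> topspace (sequence_topology A). \<forall>i\<in>F. y i = x i}"
proof -
  have "openin (sequence_topology A) {y \<in> topspace (sequence_topology A). y i = x i}" for i
  proof -
    have "continuous_map (sequence_topology A) (discrete_topology A) (\<lambda>y. y i)"
      unfolding sequence_topology_def by (rule continuous_map_product_projection) simp
    \<comment> \<open>Intersecting with \<open>A\<close> yields an open set of
      \<open>discrete_topology A\<close> even when \<open>x i\<close> lies outside
      \<open>A\<close>.\<close>
    from openin_continuous_map_preimage[OF this, of "{x i} \<inter> A"]
    have "openin (sequence_topology A) {y \<in> topspace (sequence_topology A). y i \<in> {x i} \<inter> A}"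
      by simp
    also have "{y \<in> topspace (sequence_topology A). y i \<in> {x i} \<inter> A} =
        {y \<in> topspace (sequence_topology A). y i = x i}"
      by (auto simp: topspace_sequence_topology)
    finally show ?thesis .
  qed
  \<comment> \<open>The factor \<open>topspace\<close> covers \<open>F = {}\<close>, where the
    intersection over \<open>F\<close> is all of \<open>UNIV\<close>.\<close>
  then have "openin (sequence_topology A)
      (topspace (sequence_topology A) \<inter>
       (\<Inter>i\<in>F. {y \<in> topspace (sequence_topology A). y i = x i}))"
    using assms by (cases "F = {}") (auto intro!: openin_Int openin_INT)
  moreover have "topspace (sequence_topology A) \<inter>
       (\<Inter>i\<in>F. {y \<in> topspace (sequence_topology A). y i = x i}) =
      {y \<in> topspace (sequence_topology A). \<forall>i\<in>F. y i = x i}"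
    by auto
  ultimately show ?thesis by simp
qed

text \<open>A basic open box around \<open>x\<close> restricts only finitely many coordinates;
  agreeing with \<open>x\<close> on those is enough to stay in the box.\<close>

lemma openin_sequence_topology_contains_cylinder:
  assumes "openin (sequence_topology A) U" "x \<in> U"
  obtains F where "finite F" "{y \<in> topspace (sequence_topology A). \<forall>i\<in>F. y i = x i} \<subseteq> U"
proof -
  obtain V where V: "finite {i. V i \<noteq> A}" "x \<in> Pi\<^sub>E UNIV V" "Pi\<^sub>E UNIV V \<subseteq> U"
    using assms unfolding sequence_topology_def openin_product_topology_alt by fastforce
  show ?thesis
  proof
    show "finite {i. V i \<noteq> A}" by (fact V(1))
    show "{y \<in> topspace (sequence_topology A). \<forall>i\<in>{i. V i \<noteq> A}. y i = x i} \<subseteq> U"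
    proof
      fix y assume y: "y \<in> {y \<in> topspace (sequence_topology A). \<forall>i\<in>{i. V i \<noteq> A}. y i = x i}"
      have "y i \<in> V i" for i
        using y V(2) by (cases "V i = A") (auto simp: topspace_sequence_topology PiE_def Pi_def)
      with V(3) show "y \<in> U" by (auto simp: PiE_def)
    qed
  qed
qed

text \<open>Heine-Cantor without a metric on sequences: closeness of two points means agreement on a
  finite set of coordinates.\<close>

lemma compactin_sequence_topology_uniformly_continuous:
  fixes f :: "('i \<Rightarrow> 'a) \<Rightarrow> 'b::metric_space"
  assumes X: "compactin (sequence_topology A) X"
    and f: "continuous_map (subtopology (sequence_topology A) X) euclidean f"
    and "e > 0"
  obtains F where "finite F"
    "\<And>x y. x \<in> X \<Longrightarrow> y \<in> X \<Longrightarrow> (\<forall>i\<in>F. x i = y i) \<Longrightarrow> dist (f x) (f y) < e"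
proof -
  let ?T = "sequence_topology A :: ('i \<Rightarrow> 'a) topology"
  let ?C = "\<lambda>x F. {y \<in> topspace ?T. \<forall>i\<in>F. y i = x i}"
  have sub: "X \<subseteq> topspace ?T" using X by (rule compactin_subset_topspace)
  have "\<exists>F. finite F \<and> (\<forall>y\<in>X \<inter> ?C x F. dist (f y) (f x) < e/2)" if "x \<in> X" for x
  proof -
    have "openin (subtopology ?T X) {y \<in> topspace (subtopology ?T X). f y \<in> ball (f x) (e/2)}"
      by (intro openin_continuous_map_preimage[OF f]) simp
    then obtain U where U: "openin ?T U"
        "{y \<in> topspace (subtopology ?T X). f y \<in> ball (f x) (e/2)} = U \<inter> X"
      unfolding openin_subtopology by blast
    have "x \<in> {y \<in> topspace (subtopology ?T X). f y \<in> ball (f x) (e/2)}"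
      using that sub \<open>e > 0\<close> by auto
    then have "x \<in> U" using U(2) by blast
    with U(1) obtain F where "finite F" "?C x F \<subseteq> U"
      by (rule openin_sequence_topology_contains_cylinder)
    then show ?thesis using U(2) by (fastforce simp: dist_commute)
  qed
  then have "\<forall>x\<in>X. \<exists>F. finite F \<and> (\<forall>y\<in>X \<inter> ?C x F. dist (f y) (f x) < e/2)"
    by blast
  from bchoice[OF this] obtain F where F: "\<And>x. x \<in> X \<Longrightarrow> finite (F x)"
      "\<And>x y. x \<in> X \<Longrightarrow> y \<in> X \<Longrightarrow> y \<in> ?C x (F x) \<Longrightarrow> dist (f y) (f x) < e/2"
    by blast
  have "\<exists>\<F>. finite \<F> \<and> \<F> \<subseteq> (\<lambda>x. ?C x (F x)) ` X \<and> X \<subseteq> \<Union>\<F>"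
    using sub by (intro compactinD[OF X]) (auto intro!: openin_sequence_topology_cylinder F(1))
  then obtain \<F> where \<F>: "finite \<F>" "\<F> \<subseteq> (\<lambda>x. ?C x (F x)) ` X" "X \<subseteq> \<Union>\<F>"
    by blast
  obtain K where K: "finite K" "K \<subseteq> X" "\<F> = (\<lambda>x. ?C x (F x)) ` K"
    using finite_subset_image[OF \<F>(1,2)] by blast
  show ?thesis
  \<comment> \<open>The union of the coordinate sets of a finite subcover works: if \<open>x\<close>
    lies in the cylinder around \<open>z\<close>, so does \<open>y\<close>, and both values are
    within \<open>e/2\<close> of \<open>f z\<close>.\<close>
  proof
    show "finite (\<Union>z\<in>K. F z)" using K F(1) by blast
    fix x y assume xy: "x \<in> X" "y \<in> X" "\<forall>i\<in>\<Union>z\<in>K. F z. x i = y i"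
    then obtain z where z: "z \<in> K" "x \<in> ?C z (F z)" using K(3) \<F>(3) by blast
    with xy sub have "y \<in> ?C z (F z)" by auto
    then have "dist (f x) (f z) < e/2" "dist (f y) (f z) < e/2"
      using F(2) z xy K(2) by blast+
    then show "dist (f x) (f y) < e" by (rule dist_triangle_half_l)
  qed
qed

text \<open>Where \<open>norm (f x)\<close> attains its maximum \<open>M > 0\<close>, write
  \<open>x = T y\<close> by surjectivity; then
  \<open>M = norm c * norm (f y) \<le> norm c * M\<close>.\<close>

lemma eigenvalue_norm_ge_1:
  fixes f :: "'x \<Rightarrow> complex"
  assumes "compact_space X" "continuous_map X euclidean f" "T ` topspace X = topspace X"
    and "\<And>x. x \<in> topspace X \<Longrightarrow> f (T x) = c * f x" "z \<in> topspace X" "f z \<noteq> 0"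
  shows "norm c \<ge> 1"
proof -
  have "compactin euclidean (f ` topspace X)"
    using image_compactin[of X "topspace X" euclidean f] assms(1,2)
    by (simp add: compact_space_def)
  then have "compact (norm ` f ` topspace X)"
    unfolding compactin_euclidean_iff
    by (intro compact_continuous_image) (intro continuous_on_norm_id)
  then obtain x where x: "x \<in> topspace X" "\<And>y. y \<in> topspace X \<Longrightarrow> norm (f y) \<le> norm (f x)"
    using compact_attains_sup[of "norm ` f ` topspace X"] assms(5) by fastforce
  then obtain y where y: "y \<in> topspace X" "x = T y" using assms(3) by blast
  have pos: "norm (f x) > 0" using x(2)[OF assms(5)] assms(6) by (smt (verit) zero_less_norm_iff)
  have "norm (f x) = norm c * norm (f y)" using y assms(4) by (simp add: norm_mult)
  also have "\<dots> \<le> norm c * norm (f x)" using x(2) y by (simp add: mult_left_mono)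
  finally show ?thesis using pos by simp
qed

lemma shift_funpow: "(shift ^^ n) x = (\<lambda>k::int. x (k + int n))"
  by (induction n arbitrary: x) (auto simp: shift_def algebra_simps)

lemma right_part_shift: "right_part (shift x) = shift (right_part x)"
  by (auto simp: right_part_def shift_def algebra_simps)

lemma continuous_map_right_part:
  "continuous_map (subtopology (sequence_topology A) X)
     (subtopology (sequence_topology A) (one_sided X)) right_part"
proof -
  have "continuous_map (sequence_topology A) (sequence_topology A) right_part"
    unfolding sequence_topology_def right_part_def continuous_map_componentwise_UNIV
    by (auto intro: continuous_map_product_projection)
  then show ?thesis
    by (auto simp: continuous_map_in_subtopology one_sided_def
        intro: continuous_map_from_subtopology)
qed

text \<open>One iterate replaces the limit: with \<open>dist (f x) (f y)\<close> itself as the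
  tolerance, a large enough shift brings the two values strictly closer, whereas
  \<open>norm c \<ge> 1\<close> forbids any contraction.\<close>

lemma eigenfunction_right_part:
  fixes f :: "(int \<Rightarrow> 'a) \<Rightarrow> complex"
  assumes "finite A" and X: "shift_space A X"
    and f: "continuous_map (subtopology (sequence_topology A) X) euclidean f"
    and eig: "\<And>x. x \<in> X \<Longrightarrow> f (shift x) = c * f x"
    and c: "norm c \<ge> 1"
    and xy: "x \<in> X" "y \<in> X" "right_part x = right_part y"
  shows "f x = f y"
proof (rule ccontr)
  assume "f x \<noteq> f y"
  then have "dist (f x) (f y) > 0" by simp
  moreover have "compactin (sequence_topology A) X"
    using X compact_space_sequence_topology[OF assms(1)]
    by (auto simp: shift_space_def intro: closedin_compact_space)
  ultimately obtain F where F: "finite F"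
      "\<And>u v. u \<in> X \<Longrightarrow> v \<in> X \<Longrightarrow> (\<forall>i\<in>F. u i = v i) \<Longrightarrow> dist (f u) (f v) < dist (f x) (f y)"
    using compactin_sequence_topology_uniformly_continuous[OF _ f] by metis
  \<comment> \<open>Shifting by \<open>n\<close> moves all coordinates in \<open>F\<close> to
    nonnegative positions, where \<open>x\<close> and \<open>y\<close> agree. Inserting 0 handles
    empty \<open>F\<close> and makes the argument of \<open>nat\<close> nonnegative.\<close>
  define n where "n = nat (- Min (insert 0 F))"
  have nonneg: "i + int n \<ge> 0" if "i \<in> F" for i
  proof -
    have "Min (insert 0 F) \<le> i" "Min (insert 0 F) \<le> 0"
      using that F(1) by (auto intro: Min_le)
    then show ?thesis unfolding n_def by linarith
  qed
  have iter: "(shift ^^ k) u \<in> X \<and> f ((shift ^^ k) u) = c ^ k * f u" if "u \<in> X" for u k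
    using that X eig by (induction k) (auto simp: shift_space_def)
  have "x (int k) = y (int k)" for k
    using fun_cong[OF xy(3), of k] by (simp add: right_part_def)
  then have "x k = y k" if "k \<ge> 0" for k using that by (metis nonneg_int_cases)
  then have "dist (f ((shift ^^ n) x)) (f ((shift ^^ n) y)) < dist (f x) (f y)"
    using iter xy nonneg by (intro F(2)) (auto simp: shift_funpow)
  also have "dist (f ((shift ^^ n) x)) (f ((shift ^^ n) y)) = norm c ^ n * dist (f x) (f y)"
    using iter xy by (simp add: dist_norm norm_mult norm_power flip: right_diff_distrib)
  finally show False
    using mult_right_mono[OF one_le_power[OF c, of n], of "dist (f x) (f y)"] by simp
qed

theorem proposition5p3:
  fixes A :: "'a set" and X :: "(int \<Rightarrow> 'a) set"
  assumes "finite A"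
    and "shift_space A X"
    and "recurrent X"
  shows "continuous_spectrum (subtopology (sequence_topology A) X) shift =
         continuous_spectrum (subtopology (sequence_topology A) (one_sided X)) shift"
proof -
  let ?X = "subtopology (sequence_topology A) X"
  let ?Y = "subtopology (sequence_topology A) (one_sided X)"
  have closed: "closedin (sequence_topology A) X" and shift: "shift ` X = X"
    using assms(2) by (auto simp: shift_space_def)
  have top_X: "topspace ?X = X"
    using closedin_subset[OF closed] by auto
  have top_Y: "topspace ?Y = right_part ` X"
    using closedin_subset[OF closed]
    by (auto simp: one_sided_def topspace_sequence_topology right_part_def)
  have compact: "compact_space ?X"
    using closed compact_space_sequence_topology[OF assms(1)]
    by (auto intro: compact_space_subtopology closedin_compact_space)
  \<comment> \<open>A continuous surjection from a compact space onto a Hausdorff space is closed,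
    hence a quotient map.\<close>
  have quot: "quotient_map ?X ?Y right_part"
    using compact top_X top_Y
    by (intro continuous_imp_quotient_map continuous_map_right_part)
      (auto intro: Hausdorff_space_subtopology Hausdorff_space_sequence_topology)
  show ?thesis
  proof (intro set_eqI iffI)
    fix c assume "c \<in> continuous_spectrum ?X shift"
    then obtain f z where f: "continuous_map ?X euclidean f" "z \<in> X" "f z \<noteq> 0"
        and eig: "\<And>x. x \<in> X \<Longrightarrow> f (shift x) = c * f x"
      unfolding continuous_spectrum_def top_X by blast
    have "norm c \<ge> 1"
      using eigenvalue_norm_ge_1[OF compact f(1), unfolded top_X, of shift c z] f eig shift by blast
    then have inj: "f x = f y" if "x \<in> X" "y \<in> X" "right_part x = right_part y" for x y
      using eigenfunction_right_part[OF assms(1,2) f(1) eig] that by blast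
    \<comment> \<open>By \<open>inj\<close> the chosen preimage does not affect the value, so
      \<open>g\<close> is the factor of \<open>f\<close> through \<open>right_part\<close>;
      continuity of \<open>g\<close> then follows from the quotient property.\<close>
    define g where "g = f \<circ> inv_into X right_part"
    have g: "g (right_part x) = f x" if "x \<in> X" for x
      unfolding g_def comp_def using that imageI[OF that, of right_part]
      by (intro inj inv_into_into f_inv_into_f[of "right_part x" right_part X])
    have "continuous_map ?X euclidean (g \<circ> right_part)"
      using g by (intro continuous_map_eq[OF f(1)]) (auto simp: top_X)
    then have "continuous_map ?Y euclidean g"
      using continuous_compose_quotient_map_eq[OF quot] by blast
    \<comment> \<open>Here \<open>shift (right_part x)\<close> is the right part of
      \<open>shift x\<close>, which is again in \<open>X\<close>.\<close>
    moreover have "g (shift (right_part x)) = c * g (right_part x)" if "x \<in> X" for x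
      using that shift eig by (metis g imageI right_part_shift)
    ultimately show "c \<in> continuous_spectrum ?Y shift"
      unfolding continuous_spectrum_def top_Y using f g by fastforce
  next
    fix c assume "c \<in> continuous_spectrum ?Y shift"
    then obtain g where g: "continuous_map ?Y euclidean g" "\<exists>x\<in>X. g (right_part x) \<noteq> 0"
        "\<forall>x\<in>X. g (shift (right_part x)) = c * g (right_part x)"
      unfolding continuous_spectrum_def top_Y by blast
    \<comment> \<open>The pullback is not identically zero, since every point of the one-sided space
      is some \<open>right_part x\<close> with \<open>x\<close> in \<open>X\<close>.\<close>
    then have "continuous_map ?X euclidean (g \<circ> right_part)"
      by (intro continuous_map_compose[OF continuous_map_right_part])
    then show "c \<in> continuous_spectrum ?X shift"
      unfolding continuous_spectrum_def top_X using g(2,3)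
      by (auto simp: right_part_shift intro!: exI[of _ "g \<circ> right_part"])
  qed
qed

end
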